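(* Let $p\ge 7$ be a prime, $\mathbb{K}=\overline{\mathbb{F}}_p$, and let $V$ be the irreducible non-singular curve in $\mathrm{PG}(p-2,\mathbb{K})$ defined by the equations $X_1^k+X_2^k+\cdots+X_{p-1}^k=0$ for $1\le k\le p-3$, regarded as a curve in the hyperplane $X_1+\cdots+X_{p-1}=0$, which is identified with $\mathrm{PG}(p-3,\mathbb{K})$. Then $V$ is a non-classical curve.
   Context: Let $\Gamma$ be an irreducible non-singular curve in $\mathrm{PG}(r,\mathbb{K})$ not contained in any hyperplane. For a point $P\in\Gamma$, the intersection multiplicities $I(P,\Gamma\cap\Pi)$, as $\Pi$ ranges over the hyperplanes of $\mathrm{PG}(r,\mathbb{K})$, take exactly $r+1$ values $j_0(P)<j_1(P)<\cdots<j_r(P)$, called the orders of $\Gamma$ at $P$. This sequence is the same for all but finitely many points $P$; the common sequence $(\varepsilon_0,\ldots,\varepsilon_r)$ is the order-sequence of $\Gamma$. The curve is classical if $\varepsilon_i=i$ for all $0\le i\le r$, and non-classical otherwise. The curve $V$ is not contained in any hyperplane of $\mathrm{PG}(p-3,\mathbb{K})$. *)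

theory Defs
  imports
    "HOL-Library.Poly_Mapping"
    "HOL-Library.Extended_Nat"
    "HOL-Algebra.Algebraic_Closure_Type"
    "Berlekamp_Zassenhaus.Finite_Field"
    "Jordan_Normal_Form.Matrix"
begin

section \<open>Projective space\<close>

text \<open>
  A point of \<open>PG(r, K)\<close> is the set of all its homogeneous coordinate vectors,
  which have the \<open>r + 1\<close> coordinates \<open>0, \<dots>, r\<close>.
\<close>

definition proj_point :: "'k::field vec \<Rightarrow> 'k vec set" where
  "proj_point v = {c \<cdot>\<^sub>v v | c. c \<noteq> 0}"

definition PG :: "nat \<Rightarrow> 'k::field vec set set" where
  "PG r = {proj_point v | v. v \<in> carrier_vec (Suc r) \<and> v \<noteq> 0\<^sub>v (Suc r)}"


section \<open>Homogeneous polynomials and ideals\<close>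

type_synonym 'k mpoly = "(nat \<Rightarrow>\<^sub>0 nat) \<Rightarrow>\<^sub>0 'k"

definition mpolys :: "nat \<Rightarrow> 'k::field mpoly set" where
  "mpolys r = {F. \<forall>m \<in> Poly_Mapping.keys F. Poly_Mapping.keys m \<subseteq> {..r}}"

definition mvar :: "nat \<Rightarrow> 'k::field mpoly" where
  "mvar i = Poly_Mapping.single (Poly_Mapping.single i 1) 1"

definition mconst :: "'k::field \<Rightarrow> 'k mpoly" where
  "mconst c = Poly_Mapping.single 0 c"

definition meval :: "'k::field mpoly \<Rightarrow> 'k vec \<Rightarrow> 'k" where
  "meval F v = (\<Sum>m \<in> Poly_Mapping.keys F.
     Poly_Mapping.lookup F m * (\<Prod>i \<in> Poly_Mapping.keys m. (v $ i) ^ Poly_Mapping.lookup m i))"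

definition homogeneous :: "'k::field mpoly \<Rightarrow> bool" where
  "homogeneous F \<longleftrightarrow>
     (\<exists>d. \<forall>m \<in> Poly_Mapping.keys F. (\<Sum>i \<in> Poly_Mapping.keys m. Poly_Mapping.lookup m i) = d)"

text \<open>
  Requiring \<open>F\<close> to vanish at every coordinate vector of every point amounts, over an infinite
  field, to all homogeneous components of \<open>F\<close> vanishing, so that this is the homogeneous ideal of
  the point set \<open>S\<close> in \<open>K[X\<^sub>0, \<dots>, X\<^sub>r]\<close>.
\<close>

definition vanishing_ideal :: "nat \<Rightarrow> 'k::field vec set set \<Rightarrow> 'k mpoly set" where
  "vanishing_ideal r S = {F \<in> mpolys r. \<forall>P \<in> S. \<forall>v \<in> P. meval F v = 0}"

definition mideal_prod :: "'k::field mpoly set \<Rightarrow> 'k mpoly set \<Rightarrow> 'k mpoly set" where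
  "mideal_prod I J =
     {\<Sum>j<n. f j * g j | (n :: nat) f g. (\<forall>j<n. f j \<in> I) \<and> (\<forall>j<n. g j \<in> J)}"

primrec mideal_pow :: "nat \<Rightarrow> 'k::field mpoly set \<Rightarrow> nat \<Rightarrow> 'k mpoly set" where
  "mideal_pow r I 0 = mpolys r"
| "mideal_pow r I (Suc m) = mideal_prod I (mideal_pow r I m)"


section \<open>Intersection multiplicities with hyperplanes\<close>

text \<open>
  Let \<open>I(\<Gamma>)\<close> and \<open>I(P)\<close> be the homogeneous ideals of a curve \<open>\<Gamma>\<close> and of a point \<open>P\<close> on it.
  The local ring \<open>O\<^sub>P\<close> of \<open>\<Gamma>\<close> at \<open>P\<close> consists of the fractions \<open>F / G\<close> of homogeneous polynomials
  of equal degree with \<open>G(P) \<noteq> 0\<close>, taken modulo \<open>I(\<Gamma>)\<close>, and its maximal ideal \<open>M\<^sub>P\<close> consists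
  of those with \<open>F \<in> I(P)\<close>. If \<open>F\<close> is a homogeneous polynomial and \<open>L\<close> one of the same degree with
  \<open>L(P) \<noteq> 0\<close>, then clearing denominators shows that \<open>F / L\<close> lies in the \<open>m\<close>-th power of \<open>M\<^sub>P\<close> if
  and only if \<open>G F \<in> I(P)\<^sup>m + I(\<Gamma>)\<close> for some homogeneous \<open>G\<close> with \<open>G(P) \<noteq> 0\<close>. The latter
  is the condition used here; it does not mention the choice of \<open>L\<close>.
\<close>

definition in_max_ideal_pow ::
  "nat \<Rightarrow> 'k::field vec set set \<Rightarrow> 'k vec set \<Rightarrow> nat \<Rightarrow> 'k mpoly \<Rightarrow> bool" where
  "in_max_ideal_pow r \<Gamma> P m F \<longleftrightarrow>
     (\<exists>G \<in> mpolys r. homogeneous G \<and> (\<forall>v \<in> P. meval G v \<noteq> 0) \<and>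
       (\<exists>A \<in> mideal_pow r (vanishing_ideal r {P}) m. \<exists>B \<in> vanishing_ideal r \<Gamma>. G * F = A + B))"

definition linear_form :: "'k::field vec \<Rightarrow> 'k mpoly" where
  "linear_form u = (\<Sum>i<dim_vec u. mconst (u $ i) * mvar i)"

text \<open>
  The intersection multiplicity \<open>I(P, \<Gamma> \<inter> \<Pi>)\<close> at a point \<open>P\<close> of a non-singular curve \<open>\<Gamma>\<close>, where
  \<open>\<Pi>\<close> is the hyperplane with coordinate vector \<open>u\<close>. There \<open>O\<^sub>P\<close> is a discrete valuation ring with
  valuation \<open>ord\<^sub>P(f) = sup {m. f \<in> M\<^sub>P\<^sup>m}\<close>, and the multiplicity is the order at \<open>P\<close> of the local
  equation \<open>(u\<^sub>0 X\<^sub>0 + \<dots> + u\<^sub>r X\<^sub>r) / L\<close> of \<open>\<Pi>\<close>, with \<open>L\<close> as above. It is infinite if and only if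
  \<open>\<Pi>\<close> contains the irreducible curve \<open>\<Gamma>\<close>.
\<close>

definition intersection_mult ::
  "nat \<Rightarrow> 'k::field vec set set \<Rightarrow> 'k vec set \<Rightarrow> 'k vec \<Rightarrow> enat" where
  "intersection_mult r \<Gamma> P u = Sup {enat m | m. in_max_ideal_pow r \<Gamma> P m (linear_form u)}"


section \<open>Orders and classical curves\<close>

definition has_orders ::
  "nat \<Rightarrow> 'k::field vec set set \<Rightarrow> 'k vec set \<Rightarrow> nat list \<Rightarrow> bool" where
  "has_orders r \<Gamma> P js \<longleftrightarrow> length js = Suc r \<and> sorted_wrt (<) js \<and>
     enat ` set js =
       {intersection_mult r \<Gamma> P u | u. u \<in> carrier_vec (Suc r) \<and> u \<noteq> 0\<^sub>v (Suc r)}"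

definition has_order_sequence :: "nat \<Rightarrow> 'k::field vec set set \<Rightarrow> nat list \<Rightarrow> bool" where
  "has_order_sequence r \<Gamma> es \<longleftrightarrow> finite {P \<in> \<Gamma>. \<not> has_orders r \<Gamma> P es}"

definition classical :: "nat \<Rightarrow> 'k::field vec set set \<Rightarrow> bool" where
  "classical r \<Gamma> \<longleftrightarrow> has_order_sequence r \<Gamma> [0..<Suc r]"

definition nonclassical :: "nat \<Rightarrow> 'k::field vec set set \<Rightarrow> bool" where
  "nonclassical r \<Gamma> \<longleftrightarrow> \<not> classical r \<Gamma>"


section \<open>The curve\<close>

text \<open>The coordinates \<open>X\<^sub>1, \<dots>, X\<^bsub>p-1\<^esub>\<close> have the indices \<open>0, \<dots>, p - 2\<close>.\<close>

definition power_sum_curve :: "nat \<Rightarrow> 'k::field vec set set" where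
  "power_sum_curve p =
     {P \<in> PG (p - 2). \<forall>v \<in> P. \<forall>k \<in> {1..p - 3}. (\<Sum>i<p - 1. (v $ i) ^ k) = 0}"

text \<open>
  The identification of \<open>PG(r, K)\<close> with the hyperplane \<open>X\<^sub>0 + \<dots> + X\<^bsub>r+1\<^esub> = 0\<close> of \<open>PG(r + 1, K)\<close>,
  on coordinate vectors.
\<close>

definition hyperplane_embed :: "nat \<Rightarrow> 'k::field vec \<Rightarrow> 'k vec" where
  "hyperplane_embed r v =
     vec (r + 2) (\<lambda>i. if i \<le> r then v $ i else - (\<Sum>j\<le>r. v $ j))"

definition power_sum_curve_in_hyperplane :: "nat \<Rightarrow> 'k::field vec set set" where
  "power_sum_curve_in_hyperplane p =
     {Q \<in> PG (p - 3). hyperplane_embed (p - 3) ` Q \<in> power_sum_curve p}"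

end

theory Submission
  imports Defs
begin

text \<open>
  By Newton's identities the coordinates \<open>x\<^sub>1, \<dots>, x\<^bsub>p-1\<^esub>\<close> of a point of \<open>V\<close> are the roots of a
  trinomial \<open>T\<^bsup>p-1\<^esup> + a T + b\<close>. Hence \<open>x\<^sub>i\<^bsup>p+1\<^esup> = - a x\<^sub>i\<^sup>3 - b x\<^sub>i\<^sup>2\<close>, and as \<open>p - 3 \<ge> 3\<close> the form
  \<open>\<Sum> X\<^sub>i\<^bsup>p+1\<^esup>\<close> vanishes on \<open>V\<close>. At a point \<open>P = (x\<^sub>i)\<close> of \<open>V\<close> with \<open>x\<^sub>k \<noteq> 0\<close>, the \<open>p\<close>-th power map
  being additive gives
  \<open>X\<^sub>k\<^sup>p \<Sum> x\<^sub>i\<^sup>p X\<^sub>i = \<Sum> (x\<^sub>i X\<^sub>k - x\<^sub>k X\<^sub>i)\<^sup>p X\<^sub>i + x\<^sub>k\<^sup>p \<Sum> X\<^sub>i\<^bsup>p+1\<^esup>\<close>,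
  so the hyperplane \<open>\<Sum> x\<^sub>i\<^sup>p X\<^sub>i = 0\<close> meets \<open>V\<close> at \<open>P\<close> with multiplicity at least \<open>p\<close>, which exceeds
  the largest order \<open>p - 3\<close> of a classical curve. This happens at every point, and \<open>V\<close> is
  infinite: for every \<open>t \<noteq> 1\<close> some trinomial has \<open>1\<close> and \<open>t\<close> among its roots.
\<close>

section \<open>Evaluation of multivariate polynomials\<close>

definition monom_eval :: "(nat \<Rightarrow>\<^sub>0 nat) \<Rightarrow> 'k::field vec \<Rightarrow> 'k" where
  "monom_eval m v = (\<Prod>i \<in> Poly_Mapping.keys m. (v $ i) ^ Poly_Mapping.lookup m i)"

lemma meval_altdef:
  "meval F v = (\<Sum>m \<in> Poly_Mapping.keys F. Poly_Mapping.lookup F m * monom_eval m v)"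
  by (simp add: meval_def monom_eval_def)

lemma monom_eval_superset:
  assumes "finite A" "Poly_Mapping.keys m \<subseteq> A"
  shows "monom_eval m v = (\<Prod>i \<in> A. (v $ i) ^ Poly_Mapping.lookup m i)"
  unfolding monom_eval_def using assms
  by (intro prod.mono_neutral_left) (auto simp: in_keys_iff)

lemma monom_eval_add: "monom_eval (m + n) v = monom_eval m v * monom_eval n v"
proof -
  let ?A = "Poly_Mapping.keys m \<union> Poly_Mapping.keys n"
  have "monom_eval (m + n) v = (\<Prod>i \<in> ?A. (v $ i) ^ Poly_Mapping.lookup (m + n) i)"
    using keys_add[of m n] by (intro monom_eval_superset) auto
  then show ?thesis
    by (simp add: monom_eval_superset[of ?A m] monom_eval_superset[of ?A n]
        lookup_add power_add prod.distrib)
qed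

lemma meval_0 [simp]: "meval 0 v = 0"
  by (simp add: meval_altdef)

lemma meval_single: "meval (Poly_Mapping.single m c) v = c * monom_eval m v"
  by (simp add: meval_altdef)

lemma meval_add: "meval (F + G) v = meval F v + meval G v"
  unfolding meval_altdef
  by (rule setsum_keys_plus_distrib) (auto simp: algebra_simps)

lemma meval_sum: "meval (\<Sum>i\<in>A. F i) v = (\<Sum>i\<in>A. meval (F i) v)"
  by (induction A rule: infinite_finite_induct) (auto simp: meval_add)

lemma meval_uminus: "meval (- F) v = - meval F v"
  using meval_add[of F "- F" v] by (simp add: eq_neg_iff_add_eq_0 add.commute)

lemma meval_diff: "meval (F - G) v = meval F v - meval G v"
  using meval_add[of F "- G" v] by (simp add: meval_uminus)

text \<open>Adding one monomial at a time reduces statements that are additive in \<open>F\<close>,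
  such as multiplicativity of \<open>meval\<close>, to monomials.\<close>

lemma mpoly_induct [case_names zero add]:
  assumes "P 0" "\<And>m c F. P F \<Longrightarrow> P (Poly_Mapping.single m c + F)"
  shows "P (F :: 'k::field mpoly)"
proof (induction F rule: update_induct)
  case (update F m c)
  have "Poly_Mapping.update m c F = Poly_Mapping.single m c + F"
    using update by (intro poly_mapping_eqI)
      (auto simp: lookup_update lookup_add lookup_single in_keys_iff when_def)
  then show ?case using assms(2)[OF update(3)] by simp
qed (rule assms(1))

lemma meval_mult: "meval (F * G) v = meval F v * meval G v"
proof -
  have *: "meval (Poly_Mapping.single m c * G) v = c * monom_eval m v * meval G v" for m c
    by (induction G rule: mpoly_induct)
      (auto simp: distrib_left meval_add mult_single meval_single monom_eval_add algebra_simps)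
  show ?thesis
    by (induction F rule: mpoly_induct) (auto simp: distrib_right meval_add meval_single *)
qed

lemma meval_1 [simp]: "meval 1 v = 1"
  by (simp add: meval_altdef monom_eval_def)

lemma meval_power: "meval (F ^ n) v = meval F v ^ n"
  by (induction n) (auto simp: meval_mult)

lemma meval_mconst [simp]: "meval (mconst c) v = c"
  by (simp add: mconst_def meval_single monom_eval_def)

lemma meval_mvar [simp]: "meval (mvar i) v = v $ i"
  by (simp add: mvar_def meval_single monom_eval_def)

lemma mconst_0 [simp]: "mconst 0 = 0"
  by (simp add: mconst_def)

lemma mconst_diff: "mconst (a - b) = mconst a - mconst b"
  by (simp add: mconst_def single_diff)

lemma mconst_mult: "mconst (a * b) = mconst a * mconst b"
  by (simp add: mconst_def mult_single)

lemma mconst_power: "mconst (a ^ n) = mconst a ^ n"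
  by (induction n) (auto simp: mconst_mult, simp add: mconst_def)

section \<open>The polynomial ring in the variables of index at most r\<close>

lemma mpolys_0 [simp, intro]: "0 \<in> mpolys r"
  by (simp add: mpolys_def)

lemma mpolys_1 [simp, intro]: "1 \<in> mpolys r"
  by (simp add: mpolys_def)

lemma mpolys_mconst [simp, intro]: "mconst c \<in> mpolys r"
  by (simp add: mpolys_def mconst_def)

lemma mpolys_mvar [simp, intro]: "i \<le> r \<Longrightarrow> mvar i \<in> mpolys r"
  by (simp add: mpolys_def mvar_def)

lemma mpolys_add [intro]: "F \<in> mpolys r \<Longrightarrow> G \<in> mpolys r \<Longrightarrow> F + G \<in> mpolys r"
  using keys_add[of F G] by (auto simp: mpolys_def)

lemma mpolys_uminus [intro]: "F \<in> mpolys r \<Longrightarrow> - F \<in> mpolys r"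
  by (auto simp: mpolys_def in_keys_iff)

lemma mpolys_diff [intro]: "F \<in> mpolys r \<Longrightarrow> G \<in> mpolys r \<Longrightarrow> F - G \<in> mpolys r"
  using mpolys_add[of F r "- G"] mpolys_uminus[of G r] by simp

lemma mpolys_mult [intro]:
  assumes "F \<in> mpolys r" "G \<in> mpolys r"
  shows "F * G \<in> mpolys r"
proof -
  have "Poly_Mapping.keys m \<subseteq> {..r}" if "m \<in> Poly_Mapping.keys (F * G)" for m
  proof -
    from subsetD[OF keys_mult that]
    obtain a b where "m = a + b" "a \<in> Poly_Mapping.keys F" "b \<in> Poly_Mapping.keys G"
      by blast
    with assms show ?thesis
      using keys_add[of a b] by (fastforce simp: mpolys_def)
  qed
  then show ?thesis by (simp add: mpolys_def)
qed

lemma mpolys_power [intro]: "F \<in> mpolys r \<Longrightarrow> F ^ n \<in> mpolys r"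
  by (induction n) auto

lemma mpolys_sum [intro]: "(\<And>i. i \<in> A \<Longrightarrow> F i \<in> mpolys r) \<Longrightarrow> (\<Sum>i\<in>A. F i) \<in> mpolys r"
  by (induction A rule: infinite_finite_induct) auto

section \<open>Homogeneity of monomials and powers of ideals\<close>

lemma mvar_power: "mvar i ^ n = Poly_Mapping.single (Poly_Mapping.single i n) 1"
  by (induction n) (auto simp: mvar_def mult_single single_add[symmetric])

lemma homogeneous_mvar_power: "homogeneous (mvar i ^ n :: 'k::field mpoly)"
  unfolding mvar_power homogeneous_def by auto

text \<open>The zeroth power is the whole ring, so it absorbs the cofactor \<open>G\<close>; each
  further power takes up one factor \<open>F\<close>.\<close>

lemma mideal_pow_power_mult:
  "F \<in> I \<Longrightarrow> G \<in> mpolys r \<Longrightarrow> F ^ m * G \<in> mideal_pow r I m"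
proof (induction m)
  case (Suc m)
  then have "\<exists>f g. F ^ Suc m * G = (\<Sum>j<Suc 0. f j * g j) \<and>
      (\<forall>j<Suc 0. f j \<in> I) \<and> (\<forall>j<Suc 0. g j \<in> mideal_pow r I m)"
    by (intro exI[of _ "\<lambda>_. F"] exI[of _ "\<lambda>_. F ^ m * G"]) (auto simp: mult.assoc)
  then show ?case
    unfolding mideal_pow.simps mideal_prod_def by blast
qed auto

text \<open>A positive power of an ideal consists by definition of finite sums of products.
  Splitting one factor \<open>F i\<close> off each summand exhibits the whole sum in that form at
  once.\<close>

lemma sum_power_mult_in_mideal_pow:
  fixes F G :: "nat \<Rightarrow> 'k::field mpoly"
  assumes "m > 0" "\<And>i. i < n \<Longrightarrow> F i \<in> I" "\<And>i. i < n \<Longrightarrow> G i \<in> mpolys r"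
  shows "(\<Sum>i<n. F i ^ m * G i) \<in> mideal_pow r I m"
proof -
  obtain m' where m: "m = Suc m'"
    using assms(1) gr0_implies_Suc by blast
  have "\<exists>f g. (\<Sum>i<n. F i ^ m * G i) = (\<Sum>j<n. f j * g j) \<and>
      (\<forall>j<n. f j \<in> I) \<and> (\<forall>j<n. g j \<in> mideal_pow r I m')"
    using assms by (intro exI[of _ F] exI[of _ "\<lambda>i. F i ^ m' * G i"])
      (auto simp: m mult.assoc mideal_pow_power_mult)
  then show ?thesis
    unfolding m mideal_pow.simps mideal_prod_def by blast
qed

section \<open>Frobenius on the polynomial ring\<close>

lemma of_nat_mpoly: "(of_nat n :: 'k::field mpoly) = mconst (of_nat n)"
  by (simp add: mconst_def)

text \<open>Needed because the p-th power map has to be additive on polynomials, not only on the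
  field.\<close>

lemma CHAR_mpoly: "CHAR('k::field mpoly) = CHAR('k)"
proof (rule CHAR_eqI)
  show "of_nat CHAR('k) = (0 :: 'k mpoly)"
    by (simp only: of_nat_mpoly of_nat_CHAR mconst_0)
  show "CHAR('k) dvd n" if "of_nat n = (0 :: 'k mpoly)" for n
    \<comment> \<open>Evaluation at any vector returns a constant polynomial to the field, so an
      arbitrary vector will do.\<close>
    using arg_cong[OF that, of "\<lambda>F. meval F undefined"]
    unfolding of_nat_mpoly by (simp add: of_nat_eq_0_iff_char_dvd)
qed

text \<open>Expanding \<open>((x - y) + y) ^ n\<close> avoids determining the sign of
  \<open>(-1) ^ n\<close>.\<close>

lemma freshmans_dream_diff:
  fixes x y :: "'a::comm_ring_1"
  assumes "prime CHAR('a)" "n = CHAR('a)"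
  shows "(x - y) ^ n = x ^ n - y ^ n"
  using freshmans_dream[OF assms, of "x - y" y] by (simp add: algebra_simps)


section \<open>Newton's identities\<close>

text \<open>Synthetic division: each coefficient of \<open>q\<close> is the coefficient of
  \<open>f\<close> one degree higher plus \<open>x\<close> times the next higher coefficient of
  \<open>q\<close>. The degree bound starts this recursion, which runs from the top down.\<close>

lemma coeff_prod_linear_quotient:
  fixes f q :: "'a::comm_ring_1 poly"
  assumes "f = [:- x, 1:] * q" "Polynomial.degree q < n" "k < n"
  shows "coeff q (n - 1 - k) = (\<Sum>j\<le>k. coeff f (n - j) * x ^ (k - j))"
  using assms(3)
proof (induction k)
  case 0
  have "coeff f n = coeff q (n - 1) - x * coeff q n"
    using 0 by (cases n) (auto simp: assms(1))
  moreover have "coeff q n = 0"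
    using assms(2) by (rule coeff_eq_0)
  ultimately show ?case by simp
next
  case (Suc k)
  obtain l where l: "n - Suc k = Suc l"
    using Suc.prems by (metis Suc_diff_Suc)
  have "coeff f (n - Suc k) = coeff q l - x * coeff q (Suc l)"
    by (simp add: assms(1) l)
  moreover have "l = n - 1 - Suc k" "Suc l = n - 1 - k"
    using l by auto
  ultimately have "coeff q (n - 1 - Suc k) = coeff f (n - Suc k) + x * coeff q (n - 1 - k)"
    by simp
  also have "\<dots> = coeff f (n - Suc k) + x * (\<Sum>j\<le>k. coeff f (n - j) * x ^ (k - j))"
    using Suc by simp
  also have "x * (\<Sum>j\<le>k. coeff f (n - j) * x ^ (k - j)) =
      (\<Sum>j\<le>k. coeff f (n - j) * x ^ (Suc k - j))"
    by (auto simp: sum_distrib_left Suc_diff_le algebra_simps intro!: sum.cong)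
  finally show ?case by simp
qed

text \<open>The derivative of \<open>f\<close> is the sum of the quotients f / (T - x_i). The
  identity compares the coefficients of T^(n-1-k). Its term \<open>j = k\<close> contains the zeroth
  power sum, which is \<open>n\<close>.\<close>

lemma newton_identity:
  fixes x :: "nat \<Rightarrow> 'a::idom" and n :: nat
  defines "f \<equiv> \<Prod>i<n. [:- x i, 1:]"
  assumes "k < n"
  shows "(\<Sum>j\<le>k. coeff f (n - j) * (\<Sum>i<n. x i ^ (k - j))) = of_nat (n - k) * coeff f (n - k)"
proof -
  define q where "q i = (\<Prod>j\<in>{..<n} - {i}. [:- x j, 1:])" for i
  have f: "f = [:- x i, 1:] * q i" if "i < n" for i
    unfolding f_def q_def using that by (subst prod.remove[of _ i]) auto
  have deg: "Polynomial.degree (q i) < n" if "i < n" for i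
    unfolding q_def using that by (subst degree_prod_eq_sum_degree) auto
  have "pderiv f = (\<Sum>i<n. q i)"
    unfolding f_def q_def by (simp add: pderiv_prod pderiv_pCons)
  then have "coeff (pderiv f) (n - 1 - k) = (\<Sum>i<n. coeff (q i) (n - 1 - k))"
    by (simp add: coeff_sum)
  also have "\<dots> = (\<Sum>i<n. \<Sum>j\<le>k. coeff f (n - j) * x i ^ (k - j))"
  proof (rule sum.cong[OF refl])
    fix i assume "i \<in> {..<n}"
    then show "coeff (q i) (n - 1 - k) = (\<Sum>j\<le>k. coeff f (n - j) * x i ^ (k - j))"
      using assms(2) by (intro coeff_prod_linear_quotient[OF f deg]) auto
  qed
  also have "\<dots> = (\<Sum>j\<le>k. coeff f (n - j) * (\<Sum>i<n. x i ^ (k - j)))"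
    by (subst sum.swap) (simp add: sum_distrib_left)
  finally show ?thesis
    using assms by (simp add: coeff_pderiv Suc_diff_Suc)
qed

lemma degree_prod_linear: "Polynomial.degree (\<Prod>i<n. [:- x i, 1:] :: 'a::idom poly) = n"
  by (subst degree_prod_eq_sum_degree) auto

lemma coeff_prod_linear_top: "coeff (\<Prod>i<n. [:- x i, 1:] :: 'a::idom poly) n = 1"
  using lead_coeff_prod[of "\<lambda>i. [:- x i, 1:]" "{..<n}"] by (simp add: degree_prod_linear)

text \<open>In either direction a single term of Newton's identity survives. If the power sums
  vanish, it is \<open>j = k\<close>, and n c = (n - k) c gives k c = 0 for the coefficient c, where
  k can be cancelled. If the coefficients vanish, it is \<open>j = 0\<close>, the k-th power sum
  times the leading coefficient 1.\<close>

lemma power_sums_zero_iff: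
  fixes x :: "nat \<Rightarrow> 'a::idom" and n :: nat
  defines "f \<equiv> \<Prod>i<n. [:- x i, 1:]"
  assumes "d < n" and char: "\<And>k. k \<in> {1..d} \<Longrightarrow> of_nat k \<noteq> (0 :: 'a)"
  shows "(\<forall>k\<in>{1..d}. (\<Sum>i<n. x i ^ k) = 0) \<longleftrightarrow> (\<forall>k\<in>{1..d}. coeff f (n - k) = 0)"
proof (intro iffI ballI)
  fix k assume *: "\<forall>k\<in>{1..d}. (\<Sum>i<n. x i ^ k) = 0" "k \<in> {1..d}"
  have "of_nat (n - k) * coeff f (n - k) =
      (\<Sum>j\<le>k. coeff f (n - j) * (\<Sum>i<n. x i ^ (k - j)))"
    unfolding f_def using * assms by (subst newton_identity) auto
  also have "\<dots> = (\<Sum>j\<in>{k}. coeff f (n - j) * (\<Sum>i<n. x i ^ (k - j)))"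
  proof (intro sum.mono_neutral_right ballI)
    fix j assume "j \<in> {..k} - {k}"
    then have "k - j \<in> {1..d}" using *(2) by auto
    then show "coeff f (n - j) * (\<Sum>i<n. x i ^ (k - j)) = 0" using *(1) by simp
  qed auto
  finally have "of_nat k * coeff f (n - k) = 0"
    using * assms by (auto simp: of_nat_diff algebra_simps)
  then show "coeff f (n - k) = 0"
    using char *(2) by auto
next
  fix k assume *: "\<forall>k\<in>{1..d}. coeff f (n - k) = 0" "k \<in> {1..d}"
  have "0 = (\<Sum>j\<le>k. coeff f (n - j) * (\<Sum>i<n. x i ^ (k - j)))"
    unfolding f_def using * assms by (subst newton_identity) auto
  also have "\<dots> = (\<Sum>j\<in>{0}. coeff f (n - j) * (\<Sum>i<n. x i ^ (k - j)))"
    using * by (intro sum.mono_neutral_right) auto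
  also have "\<dots> = (\<Sum>i<n. x i ^ k)"
    by (simp add: f_def coeff_prod_linear_top)
  finally show "(\<Sum>i<n. x i ^ k) = 0" by simp
qed

text \<open>Coefficients are counted from the top to match \<open>power_sums_zero_iff\<close> with
  \<open>d = n - 2\<close>; only a trinomial remains.\<close>

lemma poly_sparse:
  fixes f :: "'a::comm_ring_1 poly"
  assumes "Polynomial.degree f = n" "2 \<le> n" "\<And>k. k \<in> {1..n - 2} \<Longrightarrow> coeff f (n - k) = 0"
  shows "poly f t = lead_coeff f * t ^ n + coeff f 1 * t + coeff f 0"
proof -
  have "poly f t = (\<Sum>i\<le>n. coeff f i * t ^ i)"
    by (simp add: poly_altdef assms)
  also have "\<dots> = (\<Sum>i\<in>{0, 1, n}. coeff f i * t ^ i)"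
  proof (intro sum.mono_neutral_right ballI)
    fix i assume "i \<in> {..n} - {0, 1, n}"
    then have "n - i \<in> {1..n - 2}" "n - (n - i) = i" by auto
    then show "coeff f i * t ^ i = 0"
      using assms(3)[of "n - i"] by simp
  qed (use assms in auto)
  finally show ?thesis
    using assms by (auto simp: algebra_simps)
qed

lemma of_nat_neq_0_below_CHAR:
  "0 < k \<Longrightarrow> k < CHAR('a::semiring_1) \<Longrightarrow> of_nat k \<noteq> (0 :: 'a)"
  by (auto simp: of_nat_eq_0_iff_char_dvd dest: dvd_imp_le)

lemma power_sum_Suc_char:
  fixes x :: "nat \<Rightarrow> 'a::idom"
  assumes p: "p = CHAR('a)" "p \<ge> 7"
    and "\<And>k. k \<in> {1..p - 3} \<Longrightarrow> (\<Sum>i<p - 1. x i ^ k) = 0"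
  shows "(\<Sum>i<p - 1. x i ^ Suc p) = 0"
proof -
  define f where "f = (\<Prod>i<p - 1. [:- x i, 1:])"
  have "(\<forall>k\<in>{1..p - 3}. (\<Sum>i<p - 1. x i ^ k) = 0) \<longleftrightarrow>
      (\<forall>k\<in>{1..p - 3}. coeff f (p - 1 - k) = 0)"
    unfolding f_def using p by (intro power_sums_zero_iff of_nat_neq_0_below_CHAR) auto
  then have coeffs: "coeff f (p - 1 - k) = 0" if "k \<in> {1..p - 1 - 2}" for k
    using assms(3) that by auto
  have deg: "Polynomial.degree f = p - 1"
    by (simp add: f_def degree_prod_linear)
  define a b where "a = coeff f 1" and "b = coeff f 0"
  have "x i ^ Suc p = - a * x i ^ 3 - b * x i ^ 2" if "i < p - 1" for i
  proof -
    have "0 = poly f (x i)"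
      using that by (auto simp: f_def poly_prod)
    also have "\<dots> = lead_coeff f * x i ^ (p - 1) + a * x i + b"
      unfolding a_def b_def using p coeffs deg by (intro poly_sparse) auto
    also have "lead_coeff f = 1"
      unfolding deg by (simp add: f_def coeff_prod_linear_top)
    finally have "x i ^ (p - 1) = - a * x i - b"
      by (simp add: algebra_simps eq_neg_iff_add_eq_0)
    \<comment> \<open>Multiplying the trinomial relation by x_i^2 leaves only the exponents 3 and 2,
      which lie in the range where the power sums vanish.\<close>
    moreover have "Suc p = (p - 1) + 2"
      using p by simp
    ultimately have "x i ^ Suc p = (- a * x i - b) * x i ^ 2"
      by (simp only: power_add)
    then show ?thesis
      by (simp add: algebra_simps power2_eq_square power3_eq_cube)
  qed
  then have "(\<Sum>i<p - 1. x i ^ Suc p) = (\<Sum>i<p - 1. - a * x i ^ 3 - b * x i ^ 2)"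
    by (intro sum.cong) auto
  also have "\<dots> = - a * (\<Sum>i<p - 1. x i ^ 3) - b * (\<Sum>i<p - 1. x i ^ 2)"
    by (simp add: sum_subtractf sum_distrib_left sum_negf)
  also have "\<dots> = 0"
    using assms(3)[of 3] assms(3)[of 2] p by simp
  finally show ?thesis .
qed


section \<open>The hyperplane of high contact\<close>

text \<open>The ambient coordinate functions restricted to the hyperplane, as polynomial
  counterparts of \<open>hyperplane_embed\<close>.\<close>

definition embed_coord :: "nat \<Rightarrow> nat \<Rightarrow> 'k::field mpoly" where
  "embed_coord r i = (if i \<le> r then mvar i else - (\<Sum>j\<le>r. mvar j))"

lemma meval_embed_coord: "i < r + 2 \<Longrightarrow> meval (embed_coord r i) v = hyperplane_embed r v $ i"
  by (simp add: embed_coord_def hyperplane_embed_def meval_uminus meval_sum)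

lemma embed_coord_in_mpolys [intro]: "embed_coord r i \<in> mpolys r"
  unfolding embed_coord_def by (auto intro!: mpolys_uminus mpolys_sum)

text \<open>Restricts the ambient form with coefficients \<open>y i\<close>: eliminating the last
  coordinate subtracts its coefficient from all others.\<close>

lemma linear_form_embed:
  "linear_form (vec (Suc r) (\<lambda>i. y i - y (Suc r))) =
    (\<Sum>i<r + 2. mconst (y i) * embed_coord r i)"
proof -
  have "(\<Sum>i<r + 2. mconst (y i) * embed_coord r i) =
      (\<Sum>i<Suc r. mconst (y i) * mvar i) - mconst (y (Suc r)) * (\<Sum>j<Suc r. mvar j)"
    by (simp add: embed_coord_def lessThan_Suc_atMost)
  also have "\<dots> = (\<Sum>i<Suc r. mconst (y i - y (Suc r)) * mvar i)"
    by (simp only: mconst_diff left_diff_distrib sum_subtractf sum_distrib_left)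
  finally show ?thesis
    by (simp add: linear_form_def)
qed

lemma hyperplane_embed_smult:
  assumes "v \<in> carrier_vec (Suc r)"
  shows "hyperplane_embed r (c \<cdot>\<^sub>v v) = c \<cdot>\<^sub>v hyperplane_embed r v"
  using assms by (intro eq_vecI) (auto simp: hyperplane_embed_def sum_distrib_left)

lemma proj_point_self: "v \<in> proj_point v"
  unfolding proj_point_def by (auto intro!: exI[of _ 1])

text \<open>Applies to any point set lying, after embedding, on the hypersurface where the sum of
  the X_i^(p+1) is zero. The condition on \<open>r + 2\<close> prevents the ambient form from
  restricting to zero on the hyperplane.\<close>

lemma high_contact_hyperplane:
  fixes \<Gamma> :: "'k::field vec set set"
  assumes p: "prime p" "p = CHAR('k)"
    and \<Gamma>: "\<Gamma> \<subseteq> PG r" "P \<in> \<Gamma>"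
    and sum_zero: "\<And>Q w. Q \<in> \<Gamma> \<Longrightarrow> w \<in> Q \<Longrightarrow> (\<Sum>i<r + 2. (hyperplane_embed r w $ i) ^ Suc p) = 0"
    and r: "of_nat (r + 2) \<noteq> (0 :: 'k)"
  obtains u where "u \<in> carrier_vec (Suc r)" "u \<noteq> 0\<^sub>v (Suc r)" "intersection_mult r \<Gamma> P u \<ge> enat p"
proof -
  obtain v where v: "P = proj_point v" "v \<in> carrier_vec (Suc r)" "v \<noteq> 0\<^sub>v (Suc r)"
    using \<Gamma> unfolding PG_def by blast
  define x where "x i = hyperplane_embed r v $ i" for i
  define Z :: "nat \<Rightarrow> 'k mpoly" where "Z = embed_coord r"
  \<comment> \<open>A coordinate not vanishing at \<open>P\<close>, among those that are plain
    variables: \<open>Z k ^ p\<close> will be the homogeneous denominator \<open>G\<close> of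
    \<open>in_max_ideal_pow\<close>.\<close>
  obtain k where k: "k \<le> r" "v $ k \<noteq> 0"
    using v(2,3) by (metis carrier_vecD eq_vecI index_zero_vec less_Suc_eq_le)
  have xk: "x k = v $ k" and Zk: "Z k = mvar k"
    using k by (auto simp: x_def Z_def hyperplane_embed_def embed_coord_def)
  have p0: "p > 0" using p by (simp add: prime_gt_0_nat)
  have dream: "(F - G) ^ p = F ^ p - G ^ p" for F G :: "'k mpoly"
    by (rule freshmans_dream_diff) (simp_all add: CHAR_mpoly p flip: p(2))
  \<comment> \<open>As p + 1 = 1 in the field, the gradient of the sum of the X_i^(p+1) is (X_i^p).
    Thus \<open>u\<close> is the tangent hyperplane of that hypersurface at \<open>P\<close>,
    written in the coordinates of PG(r, K).\<close>
  define u where "u = vec (Suc r) (\<lambda>i. x i ^ p - x (Suc r) ^ p)"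
  \<comment> \<open>The 2 by 2 minors of the coordinates against those of \<open>P\<close>; they
    vanish at \<open>P\<close>.\<close>
  define Y where "Y i = mconst (x i) * Z k - mconst (x k) * Z i" for i
  \<comment> \<open>\<open>A\<close> will lie in the p-th power of the ideal of \<open>P\<close>,
    and \<open>B\<close> in the ideal of the curve.\<close>
  define A where "A = (\<Sum>i<r + 2. Y i ^ p * Z i)"
  define B where "B = mconst (x k ^ p) * (\<Sum>i<r + 2. Z i ^ Suc p)"
  have Yp: "Y i ^ p = mconst (x i ^ p) * Z k ^ p - mconst (x k ^ p) * Z i ^ p" for i
    by (simp add: Y_def dream power_mult_distrib mconst_power)
  have "A + B = (\<Sum>i<r + 2. Z k ^ p * (mconst (x i ^ p) * Z i))"
    unfolding A_def B_def sum_distrib_left sum.distrib[symmetric]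
    by (intro sum.cong) (simp_all add: Yp algebra_simps)
  also have "\<dots> = Z k ^ p * linear_form u"
    unfolding u_def linear_form_embed[of r "\<lambda>i. x i ^ p"] Z_def by (simp only: sum_distrib_left)
  finally have AB: "Z k ^ p * linear_form u = A + B" ..
  have A: "A \<in> mideal_pow r (vanishing_ideal r {P}) p"
    unfolding A_def
  proof (rule sum_power_mult_in_mideal_pow)
    fix i assume i: "i < r + 2"
    have "meval (Y i) w = 0" if w: "w \<in> P" for w
    proof -
      obtain c where c: "w = c \<cdot>\<^sub>v v"
        using w by (auto simp: v proj_point_def)
      have "hyperplane_embed r w = c \<cdot>\<^sub>v hyperplane_embed r v"
        unfolding c by (rule hyperplane_embed_smult[OF v(2)])
      moreover have "dim_vec (hyperplane_embed r v) = r + 2"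
        by (simp add: hyperplane_embed_def)
      ultimately have "hyperplane_embed r w $ j = c * x j" if "j < r + 2" for j
        using that by (simp add: x_def)
      then show ?thesis
        using i k by (simp add: Y_def Z_def meval_diff meval_mult meval_embed_coord)
    qed
    then show "Y i \<in> vanishing_ideal r {P}"
      by (auto simp: vanishing_ideal_def Y_def Z_def)
  qed (use p0 in \<open>auto simp: Z_def\<close>)
  have "meval (\<Sum>i<r + 2. Z i ^ Suc p) w = 0" if "Q \<in> \<Gamma>" "w \<in> Q" for Q w
  proof -
    have "meval (\<Sum>i<r + 2. Z i ^ Suc p) w = (\<Sum>i<r + 2. (hyperplane_embed r w $ i) ^ Suc p)"
      unfolding meval_sum meval_power Z_def by (intro sum.cong) (simp_all add: meval_embed_coord)
    then show ?thesis
      using sum_zero[OF that] by simp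
  qed
  moreover have "B \<in> mpolys r"
    unfolding B_def Z_def by (intro mpolys_mult mpolys_sum mpolys_power) auto
  ultimately have B: "B \<in> vanishing_ideal r \<Gamma>"
    by (auto simp: vanishing_ideal_def B_def meval_mult simp del: power_Suc sum.lessThan_Suc)
  have "\<forall>w\<in>P. meval (Z k ^ p) w \<noteq> 0"
    using k v(2) by (auto simp: v(1) proj_point_def Zk meval_power)
  then have "in_max_ideal_pow r \<Gamma> P p (linear_form u)"
    unfolding in_max_ideal_pow_def using A B AB k
    by (intro bexI[of _ "Z k ^ p"] conjI bexI[of _ A] bexI[of _ B])
      (auto simp: Zk homogeneous_mvar_power)
  then have "intersection_mult r \<Gamma> P u \<ge> enat p"
    unfolding intersection_mult_def by (intro Sup_upper) auto
  moreover have "u \<noteq> 0\<^sub>v (Suc r)"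
  proof
    assume u: "u = 0\<^sub>v (Suc r)"
    \<comment> \<open>If \<open>u\<close> were zero, injectivity of Frobenius would make all r + 2
      embedded coordinates equal. Their sum is zero, so the common value would vanish, against
      \<open>x k\<close> being nonzero.\<close>
    have eq: "x i = x (Suc r)" if "i < r + 2" for i
    proof (cases "i = Suc r")
      case False
      then have "i < Suc r" using that by simp
      then have "u $ i = x i ^ p - x (Suc r) ^ p" "u $ i = 0"
        unfolding u_def by (simp, subst u[unfolded u_def], simp)
      moreover have "(x i - x (Suc r)) ^ p = x i ^ p - x (Suc r) ^ p"
        by (rule freshmans_dream_diff) (use p in auto)
      ultimately show ?thesis using p0 by simp
    qed simp
    have "{..<r + 2} = insert (Suc r) {..r}"
      by auto
    then have "(\<Sum>i<r + 2. x i) = x (Suc r) + (\<Sum>i\<le>r. x i)"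
      by simp
    moreover have "(\<Sum>i\<le>r. x i) = (\<Sum>i\<le>r. v $ i)"
      by (intro sum.cong) (auto simp: x_def hyperplane_embed_def)
    moreover have "x (Suc r) = - (\<Sum>i\<le>r. v $ i)"
      by (simp add: x_def hyperplane_embed_def)
    ultimately have "(\<Sum>i<r + 2. x i) = 0"
      by simp
    moreover have "(\<Sum>i<r + 2. x i) = (\<Sum>i<r + 2. x (Suc r))"
      by (intro sum.cong refl eq) simp
    ultimately have "of_nat (r + 2) * x (Suc r) = 0"
      by (simp only: sum_constant card_lessThan)
    then have "x (Suc r) = 0"
      using r by (simp only: mult_eq_0_iff simp_thms)
    moreover have "x k = x (Suc r)"
      using k by (intro eq) simp
    ultimately show False
      using k xk by simp
  qed
  ultimately show thesis
    using that[of u] by (simp add: u_def)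
qed


section \<open>Points of the curve\<close>

text \<open>Over a finite field, 1 plus the product of all T - a is non-constant but takes the value
  1 everywhere.\<close>

lemma infinite_UNIV_alg_closed: "infinite (UNIV :: 'a::alg_closed_field set)"
proof
  assume fin: "finite (UNIV :: 'a set)"
  define f :: "'a poly" where "f = [:1:] + (\<Prod>a\<in>UNIV. [:- a, 1:])"
  have "Polynomial.degree (\<Prod>a\<in>UNIV. [:- a, 1:] :: 'a poly) = card (UNIV :: 'a set)"
    by (subst degree_prod_eq_sum_degree) auto
  then have "Polynomial.degree f > 0"
    unfolding f_def using fin by (subst degree_add_eq_right) (auto simp: card_gt_0_iff)
  then obtain a where "poly f a = 0"
    using alg_closed_imp_poly_has_root by blast
  moreover have "poly (\<Prod>a\<in>UNIV. [:- a, 1:]) a = 0"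
    using fin by (simp add: poly_prod)
  ultimately show False
    by (simp add: f_def)
qed

text \<open>The sequence lists the roots of T^n + a T - (1 + a), which always has the root 1. Its
  middle coefficients vanish, hence so do the power sums.\<close>

lemma exists_zero_power_sums:
  fixes t :: "'a::alg_closed_field"
  assumes "t \<noteq> 1" "2 \<le> n" and char: "\<And>k. k \<in> {1..n - 2} \<Longrightarrow> of_nat k \<noteq> (0 :: 'a)"
  obtains x where "x 0 = 1" "x 1 = t" "\<And>k. k \<in> {1..n - 2} \<Longrightarrow> (\<Sum>i<n. x i ^ k) = 0"
proof -
  \<comment> \<open>The solution of t^n + a t - 1 - a = 0, so that t is a root as well.\<close>
  define a where "a = (t ^ n - 1) / (1 - t)"
  define f where "f = monom 1 n + [:- 1 - a, a:]"
  have deg: "Polynomial.degree f = n"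
  proof (cases "n = 2")
    case True
    then show ?thesis
      by (auto simp: f_def monom_altdef numeral_2_eq_2)
  next
    case False
    then have "Polynomial.degree [:- 1 - a, a:] < n"
      using assms(2) by (auto simp: degree_pCons_eq_if)
    then show ?thesis
      unfolding f_def by (subst degree_add_eq_left) (auto simp: degree_monom_eq)
  qed
  have coeff_f: "coeff f k = (if k = n then 1 else 0)" if "k \<ge> 2" for k
    using that by (auto simp: f_def coeff_pCons split: nat.splits)
  have lead: "lead_coeff f = 1"
    using assms(2) by (simp add: deg coeff_f)
  have "f \<noteq> 0"
    using lead by auto
  then obtain M where M: "size M = n" "f = (\<Prod>x\<in>#M. [:- x, 1:])"
    using alg_closed_imp_factorization[of f] lead deg by auto
  have root: "y \<in># M" if "poly f y = 0" for y
    using that by (auto simp: M(2) poly_prod_mset)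
  have "poly f 1 = 0"
    by (simp add: f_def poly_monom)
  then have "1 \<in># M" by (rule root)
  have "a * (1 - t) = t ^ n - 1"
    using assms(1) by (simp add: a_def)
  then have "poly f t = 0"
    by (simp add: f_def poly_monom algebra_simps)
  \<comment> \<open>As t differs from 1, it survives the removal of one copy of the root 1; so the
    roots can be listed with 1 and t in front.\<close>
  then have "t \<in># M - {#1#}"
    using root[of t] assms(1) by (simp add: in_diff_count)
  then obtain N where "M - {#1#} = add_mset t N"
    by (blast dest: multi_member_split)
  then have "M = add_mset 1 (add_mset t N)"
    using \<open>1 \<in># M\<close> by (metis insert_DiffM)
  moreover obtain ys where "mset ys = N"
    using ex_mset by blast
  ultimately have xs: "M = mset (1 # t # ys)" by simp
  define x where "x i = (1 # t # ys) ! i" for i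
  have "f = (\<Prod>y\<leftarrow>1 # t # ys. [:- y, 1:])"
    unfolding M(2) xs by (simp flip: prod_mset_prod_list)
  also have "\<dots> = (\<Prod>i<n. [:- x i, 1:])"
    using M(1) unfolding prod.list_conv_set_nth
    by (intro prod.cong) (auto simp: xs x_def simp del: list.map)
  finally have f: "f = (\<Prod>i<n. [:- x i, 1:])" .
  have "(\<forall>k\<in>{1..n - 2}. (\<Sum>i<n. x i ^ k) = 0) \<longleftrightarrow> (\<forall>k\<in>{1..n - 2}. coeff f (n - k) = 0)"
    unfolding f using assms(2) char by (intro power_sums_zero_iff) auto
  moreover have "\<forall>k\<in>{1..n - 2}. coeff f (n - k) = 0"
    by (auto simp: coeff_f)
  ultimately show thesis
    by (intro that[of x]) (auto simp: x_def)
qed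

text \<open>A coordinate normalised to 1 forces the scalar between two representatives to be
  1.\<close>

lemma proj_point_eqD:
  fixes v w :: "'k::field vec"
  assumes "proj_point v = proj_point w" "i < dim_vec v" "i < dim_vec w" "v $ i = 1" "w $ i = 1"
  shows "v = w"
proof -
  obtain c where c: "v = c \<cdot>\<^sub>v w"
    using proj_point_self[of v] unfolding assms(1) by (auto simp: proj_point_def)
  then have "c = 1"
    using assms by simp
  then show ?thesis
    using c by simp
qed

lemma infinite_power_sum_curve_in_hyperplane:
  assumes "p = CHAR('k)" "p \<ge> 7"
  shows "infinite (power_sum_curve_in_hyperplane p :: 'k::alg_closed_field vec set set)"
proof -
  have "\<exists>P \<in> power_sum_curve_in_hyperplane p. \<exists>v. P = proj_point v \<and> dim_vec v = p - 2 \<and>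
      v $ 0 = 1 \<and> v $ 1 = t" if "t \<in> UNIV - {1}" for t :: 'k
  proof -
    have p: "p - 1 = Suc (p - 2)" "Suc (p - 3) = p - 2" "p - 3 + 2 = p - 1" "p - 1 - 2 = p - 3"
      using assms by auto
    have "of_nat k \<noteq> (0 :: 'k)" if "k \<in> {1..p - 1 - 2}" for k
      using that assms by (intro of_nat_neq_0_below_CHAR) auto
    moreover have "t \<noteq> 1" "2 \<le> p - 1"
      using \<open>t \<in> UNIV - {1}\<close> assms by auto
    ultimately obtain x where x: "x 0 = 1" "x 1 = t"
        "\<And>k. k \<in> {1..p - 1 - 2} \<Longrightarrow> (\<Sum>i<p - 1. x i ^ k) = 0"
      using exists_zero_power_sums[of t "p - 1"] by blast
    note x = x(1,2) x(3)[unfolded p(4)]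
    define v where "v = vec (p - 2) x"
    define w where "w = vec (p - 1) x"
    \<comment> \<open>The first power sum recovers the last coordinate from the others, so embedding
      the truncated vector \<open>v\<close> gives back \<open>w\<close>.\<close>
    have "(\<Sum>i<p - 2. x i) + x (p - 2) = 0"
      using x(3)[of 1] assms(2) unfolding p(1) by simp
    moreover have "{..p - 3} = {..<p - 2}"
      using p(2) by (metis lessThan_Suc_atMost)
    ultimately have "x (p - 2) = - (\<Sum>j\<le>p - 3. x j)"
      by (simp add: eq_neg_iff_add_eq_0 add.commute)
    moreover have "(\<Sum>j\<le>p - 3. v $ j) = (\<Sum>j\<le>p - 3. x j)"
      using p(2) by (intro sum.cong) (auto simp: v_def)
    moreover have "i = p - 2" if "i < p - 1" "\<not> i \<le> p - 3" for i
      using that by linarith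
    ultimately have vw: "hyperplane_embed (p - 3) v = w"
      unfolding w_def hyperplane_embed_def p(3) using p(2)
      by (intro eq_vecI) (auto simp: v_def)
    have v: "v \<in> carrier_vec (Suc (p - 3))" and w: "w \<in> carrier_vec (Suc (p - 2))"
      unfolding v_def w_def p(1)[symmetric] p(2) by simp_all
    have v0: "v $ 0 = 1" "v $ 1 = t" "w $ 0 = 1"
      using assms x by (auto simp: v_def w_def)
    have "v \<noteq> 0\<^sub>v (Suc (p - 3))" "w \<noteq> 0\<^sub>v (Suc (p - 2))"
      using v0 by auto
    with v w have PG: "proj_point v \<in> PG (p - 3)" "proj_point w \<in> PG (p - 2)"
      unfolding PG_def by blast+
    \<comment> \<open>The embedding commutes with scaling, so it maps the representatives of one
      point onto those of the other.\<close>
    have "hyperplane_embed (p - 3) ` proj_point v = proj_point w"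
      unfolding proj_point_def vw[symmetric] by (force simp: hyperplane_embed_smult[OF v] image_iff)
    moreover have "proj_point w \<in> power_sum_curve p"
      unfolding power_sum_curve_def
    proof (intro CollectI conjI ballI PG)
      fix y k assume "y \<in> proj_point w" and k: "k \<in> {1..p - 3}"
      then obtain c where "y = c \<cdot>\<^sub>v w"
        by (auto simp: proj_point_def)
      then have "(\<Sum>i<p - 1. (y $ i) ^ k) = (\<Sum>i<p - 1. c ^ k * x i ^ k)"
        by (intro sum.cong) (auto simp: w_def power_mult_distrib)
      also have "\<dots> = 0"
        using x(3)[OF k] by (simp flip: sum_distrib_left)
      finally show "(\<Sum>i<p - 1. (y $ i) ^ k) = 0" .
    qed
    ultimately have "proj_point v \<in> power_sum_curve_in_hyperplane p"
      using PG by (simp add: power_sum_curve_in_hyperplane_def)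
    then show ?thesis
      using v0 by (intro bexI[of _ "proj_point v"] exI[of _ v]) (auto simp: v_def)
  qed
  then obtain P v where P: "\<And>t. t \<in> UNIV - {1} \<Longrightarrow> P t \<in> power_sum_curve_in_hyperplane p \<and>
      P t = proj_point (v t) \<and> dim_vec (v t) = p - 2 \<and> v t $ 0 = 1 \<and> v t $ 1 = (t :: 'k)"
    by metis
  \<comment> \<open>The representatives are normalised by first coordinate 1, and the second
    coordinate returns the parameter.\<close>
  have "inj_on P (UNIV - {1})"
  proof (rule inj_onI)
    fix s t assume *: "s \<in> UNIV - {1}" "t \<in> UNIV - {1}" "P s = P t"
    have "v s = v t"
      by (rule proj_point_eqD[where i = 0]) (use P[OF *(1)] P[OF *(2)] *(3) assms in auto)
    then show "s = t"
      using P[OF *(1)] P[OF *(2)] by metis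
  qed
  moreover have "P ` (UNIV - {1}) \<subseteq> power_sum_curve_in_hyperplane p"
    using P by blast
  moreover have "infinite (UNIV - {1 :: 'k})"
    by (simp add: infinite_UNIV_alg_closed)
  ultimately show ?thesis
    using inj_on_finite by blast
qed

section \<open>Non-classicality of the curve\<close>

lemma power_sum_curve_in_hyperplane_sum_zero:
  fixes w :: "'k::field vec"
  assumes "p = CHAR('k)" "p \<ge> 7" "Q \<in> power_sum_curve_in_hyperplane p" "w \<in> Q"
  shows "(\<Sum>i<p - 1. (hyperplane_embed (p - 3) w $ i) ^ Suc p) = 0"
  using assms(3,4) unfolding power_sum_curve_in_hyperplane_def power_sum_curve_def
  by (intro power_sum_Suc_char assms) auto

text \<open>The exceptional set in \<open>has_order_sequence\<close> turns out to be the entire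
  curve, which is infinite.\<close>

lemma nonclassical_power_sum_curve:
  assumes p: "prime p" "p = CHAR('k)" "p \<ge> 7"
  shows "nonclassical (p - 3) (power_sum_curve_in_hyperplane p :: 'k::alg_closed_field vec set set)"
proof -
  define \<Gamma> where "\<Gamma> = (power_sum_curve_in_hyperplane p :: 'k vec set set)"
  have r: "p - 3 + 2 = p - 1" using p by simp
  have "\<not> has_orders (p - 3) \<Gamma> P [0..<Suc (p - 3)]" if P: "P \<in> \<Gamma>" for P
  proof
    assume orders: "has_orders (p - 3) \<Gamma> P [0..<Suc (p - 3)]"
    have "\<Gamma> \<subseteq> PG (p - 3)"
      by (auto simp: \<Gamma>_def power_sum_curve_in_hyperplane_def)
    moreover have "of_nat (p - 3 + 2) \<noteq> (0 :: 'k)"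
      using p by (intro of_nat_neq_0_below_CHAR) auto
    moreover have "(\<Sum>i<p - 3 + 2. (hyperplane_embed (p - 3) w $ i) ^ Suc p) = 0"
      if "Q \<in> \<Gamma>" "w \<in> Q" for Q w
      unfolding r using that p by (intro power_sum_curve_in_hyperplane_sum_zero) (auto simp: \<Gamma>_def)
    ultimately obtain u where u: "u \<in> carrier_vec (Suc (p - 3))" "u \<noteq> 0\<^sub>v (Suc (p - 3))"
        "enat p \<le> intersection_mult (p - 3) \<Gamma> P u"
      using high_contact_hyperplane[OF p(1,2) _ P] by blast
    \<comment> \<open>Classical orders would bound every hyperplane multiplicity at \<open>P\<close>
      by p - 3; this also excludes an infinite value.\<close>
    then have "intersection_mult (p - 3) \<Gamma> P u \<in> enat ` set [0..<Suc (p - 3)]"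
      using orders unfolding has_orders_def by blast
    with u(3) p(3) show False by auto
  qed
  then have "{P \<in> \<Gamma>. \<not> has_orders (p - 3) \<Gamma> P [0..<Suc (p - 3)]} = \<Gamma>"
    by blast
  then show ?thesis
    using infinite_power_sum_curve_in_hyperplane[OF p(2,3)]
    unfolding nonclassical_def classical_def has_order_sequence_def \<Gamma>_def by simp
qed

theorem theorem8p11:
  fixes p :: nat
  assumes "p = CARD('p :: prime_card)"
    and "prime p"
    and "p \<ge> 7"
  shows "nonclassical (p - 3)
           (power_sum_curve_in_hyperplane p :: 'p mod_ring alg_closure vec set set)"
proof -
  have "p = CHAR('p mod_ring alg_closure)"
    using assms(1) by simp
  then show ?thesis
    by (rule nonclassical_power_sum_curve[OF assms(2) _ assms(3)])
qed

end
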